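(* Let $n\ge 1$, let $E$ be a set of ordered pairs $(i,j)$ with $i,j\in\{1,\dots,n\}$, $i\neq j$, and for each $(i,j)\in E$ let a scalar $a_{ij}\in\mathbb{R}_{\max}$ be given; consider the system of inequalities $a_{ij}\le x_i-x_j$, $(i,j)\in E$. Let $A$ be the $n\times n$ max-plus matrix with $A_{ii}=0$ for all $i$, $A_{ij}=a_{ij}$ if $(i,j)\in E$, and $A_{ij}=-\infty$ if $i\ne j$ and $(i,j)\notin E$. Then the set $$X=\{x\in\mathbb{R}^n : A_{ij}\le x_i-x_j \text{ for all } i,j\}$$ is nonempty if and only if $A$ is definite.
   Context: $\mathbb{R}_{\max}=\mathbb{R}\cup\{-\infty\}$ is the max-plus semiring (addition $\max$, multiplication $+$), written here with conventional arithmetic; a max-plus matrix is a matrix with entries in $\mathbb{R}_{\max}$. Maximal cycle mean: $\lambda(A)=\max_{\tau}\frac{1}{|K(\tau)|}\sum_{i\in K(\tau)}A_{i\tau(i)}$, where $\tau$ ranges over all cyclic permutations of nonempty subsets $K(\tau)\subseteq\{1,\dots,n\}$ (singletons included). $A$ is definite if $\lambda(A)=0$ and $A_{ii}=0$ for all $i$. *)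

theory Defs
  imports "HOL-Analysis.Analysis" "HOL-Combinatorics.Orbits"
begin

text \<open>
  The max-plus semiring is the set of extended reals other than \<open>\<infinity>\<close>. On this set the library's
  \<open>max\<close>, \<open>+\<close>, \<open>\<Sum>\<close>, \<open>\<le>\<close> and division by a positive integer are the intended operations, with
  \<open>-\<infinity>\<close> absorbing for addition. Matrices and vectors are indexed by a type \<open>'n\<close> of class
  \<open>finite\<close>, which stands for \<open>{1,\<dots>,n}\<close> with \<open>n = CARD('n) \<ge> 1\<close>.
\<close>

definition Rmax :: "ereal set" where
  "Rmax = range ereal \<union> {-\<infinity>}"

text \<open>
  Here \<open>\<tau> permutes K\<close> fixes everything outside \<open>K\<close>, and \<open>cyclic_on \<tau> K\<close> says that \<open>K\<close> is a single
  orbit of \<open>\<tau>\<close>, so that \<open>K\<close> is nonempty; for a singleton \<open>K\<close> the permutation \<open>\<tau>\<close> is the identity.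
\<close>

definition cyclic_perms :: "(('n::finite \<Rightarrow> 'n) \<times> 'n set) set" where
  "cyclic_perms = {(\<tau>, K). \<tau> permutes K \<and> cyclic_on \<tau> K}"

definition cycle_mean :: "ereal^'n^'n \<Rightarrow> ('n::finite \<Rightarrow> 'n) \<Rightarrow> 'n set \<Rightarrow> ereal" where
  "cycle_mean A \<tau> K = (\<Sum>i\<in>K. A $ i $ \<tau> i) / ereal (real (card K))"

definition max_cycle_mean :: "ereal^'n^'n \<Rightarrow> ereal" where
  "max_cycle_mean A = Max {cycle_mean A \<tau> K | \<tau> K. (\<tau>, K) \<in> cyclic_perms}"

text \<open>The maximum is taken over a finite nonempty set:\<close>

lemma finite_cyclic_perms: "finite (cyclic_perms :: (('n::finite \<Rightarrow> 'n) \<times> 'n set) set)"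
  by (rule finite)

lemma singleton_cyclic_perms: "(id, {i}) \<in> cyclic_perms"
proof -
  have "orbit id i = {i}"
    by (auto elim: orbit.induct intro: orbit.base[of id i, simplified])
  then show ?thesis
    by (auto simp: cyclic_perms_def cyclic_on_def permutes_id)
qed

definition definite :: "ereal^'n^'n \<Rightarrow> bool" where
  "definite A \<longleftrightarrow> max_cycle_mean A = 0 \<and> (\<forall>i. A $ i $ i = 0)"

definition system_matrix :: "('n \<times> 'n) set \<Rightarrow> ('n \<Rightarrow> 'n \<Rightarrow> ereal) \<Rightarrow> ereal^'n^'n" where
  "system_matrix E a =
     (\<chi> i j. if i = j then 0 else if (i, j) \<in> E then a i j else -\<infinity>)"

definition solution_set :: "ereal^'n^'n \<Rightarrow> (real^'n) set" where
  "solution_set A = {x. \<forall>i j. A $ i $ j \<le> ereal (x $ i - x $ j)}"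

end

theory Submission
  imports Defs "HOL-Combinatorics.Cycles"
begin

text \<open>
  Summing the inequalities along a cycle telescopes, so solvability forces all cycle means to be
  nonpositive. Conversely, let \<open>x\<^sub>i\<close> be the maximal weight of a simple path starting at \<open>i\<close>. The
  trivial path makes \<open>x\<^sub>i\<close> finite. Prepending \<open>i\<close> to an optimal path from \<open>j\<close> either gives a simple
  path, or closes a cycle at \<open>i\<close>, which has weight at most \<open>0\<close> and can be cut off;
  in both cases \<open>A\<^sub>i\<^sub>j + x\<^sub>j \<le> x\<^sub>i\<close>.
\<close>

text \<open>A list records the visited vertices. Zipping stops at the shorter list, so the last
  vertex contributes no arc.\<close>

definition walk_weight :: "('a \<Rightarrow> 'a \<Rightarrow> 'b::monoid_add) \<Rightarrow> 'a list \<Rightarrow> 'b" where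
  "walk_weight w p = sum_list (map2 w p (tl p))"

lemma walk_weight_singleton [simp]: "walk_weight w [i] = 0"
  by (simp add: walk_weight_def)

lemma walk_weight_Cons_Cons [simp]:
  "walk_weight w (i # j # p) = w i j + walk_weight w (j # p)"
  by (simp add: walk_weight_def)

text \<open>The cut vertex \<open>i\<close> ends one piece and starts the other, so every arc is
  counted exactly once.\<close>

lemma walk_weight_append:
  "walk_weight w (p @ i # q) = walk_weight w (p @ [i]) + walk_weight w (i # q)"
proof (induction p)
  case (Cons j p)
  then show ?case by (cases p) (simp_all add: add.assoc)
qed simp

text \<open>Links closed walks to permutations: \<open>rotate1\<close> lists the successors along
  the cycle, which are also the images under \<open>cycle_of_list\<close>.\<close>

lemma walk_weight_closed:
  "walk_weight w (i # p @ [i]) = sum_list (map2 w (i # p) (rotate1 (i # p)))"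
  using zip_append1[of "i # p" "[i]" "p @ [i]"] by (simp add: walk_weight_def)

lemma walk_weight_less_top:
  fixes w :: "'a \<Rightarrow> 'a \<Rightarrow> ereal"
  assumes "\<And>i j. w i j < \<infinity>"
  shows "walk_weight w (i # p) < \<infinity>"
proof (induction p arbitrary: i)
  case (Cons j p)
  then show ?case using assms[of i j] by simp
qed simp

lemma map_cycle_of_list:
  assumes "distinct c"
  shows "map (cycle_of_list c) c = rotate1 c"
  using cyclic_rotation[OF assms, of 1] by simp

lemma cyclic_on_cycle_of_list:
  assumes "distinct c" "c \<noteq> []"
  shows "cyclic_on (cycle_of_list c) (set c)"
proof -
  let ?f = "cycle_of_list c"
  have pow: "(?f ^^ k) (c ! 0) = c ! (k mod length c)" for k
  proof -
    have "(?f ^^ k) (c ! 0) = map (?f ^^ k) c ! 0"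
      using assms by simp
    also have "\<dots> = c ! (k mod length c)"
      using assms by (simp add: cyclic_rotation nth_rotate del: rotate_Suc)
    finally show ?thesis .
  qed
  have "orbit ?f (c ! 0) = set c"
  proof
    show "orbit ?f (c ! 0) \<subseteq> set c"
      using assms by (auto simp: orbit_altdef pow)
    show "set c \<subseteq> orbit ?f (c ! 0)"
    proof
      fix x assume "x \<in> set c"
      then obtain k where "k < length c" "x = c ! k"
        by (auto simp: in_set_conv_nth)
      \<comment> \<open>An orbit consists of the strictly positive powers; one extra full turn
        covers the case \<open>k = 0\<close>.\<close>
      then have "x = (?f ^^ (k + length c)) (c ! 0)" "k + length c > 0"
        by (auto simp add: pow simp del: funpow_add)
      then show "x \<in> orbit ?f (c ! 0)"
        unfolding orbit_altdef by blast
    qed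
  qed
  then show ?thesis
    using assms unfolding cyclic_on_def by (metis length_greater_0_conv nth_mem)
qed

lemma max_cycle_mean_le_iff:
  fixes A :: "ereal^'n::finite^'n"
  shows "max_cycle_mean A \<le> r \<longleftrightarrow> (\<forall>(\<tau>, K)\<in>cyclic_perms. cycle_mean A \<tau> K \<le> r)"
proof -
  have "{cycle_mean A \<tau> K |\<tau> K. (\<tau>, K) \<in> cyclic_perms} = case_prod (cycle_mean A) ` cyclic_perms"
    by auto
  moreover have "(cyclic_perms :: (('n \<Rightarrow> 'n) \<times> 'n set) set) \<noteq> {}"
    using singleton_cyclic_perms by blast
  ultimately show ?thesis
    by (simp add: max_cycle_mean_def Max_le_iff finite_cyclic_perms case_prod_unfold)
qed

lemma cycle_mean_le_0_iff:
  assumes "(\<tau>, K) \<in> cyclic_perms"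
  shows "cycle_mean A \<tau> K \<le> 0 \<longleftrightarrow> (\<Sum>i\<in>K. A $ i $ \<tau> i) \<le> 0"
proof -
  have "card K > 0"
    using assms by (auto simp: cyclic_perms_def cyclic_on_def card_gt_0_iff)
  then show ?thesis
    by (simp add: cycle_mean_def ereal_divide_le_pos)
qed

lemma max_cycle_mean_ge_diagonal: "A $ i $ i \<le> max_cycle_mean A"
proof -
  have "cycle_mean A id {i} \<le> max_cycle_mean A"
    using max_cycle_mean_le_iff[of A "max_cycle_mean A"] singleton_cyclic_perms[of i] by blast
  then show ?thesis
    by (simp add: cycle_mean_def flip: one_ereal_def)
qed

text \<open>Singleton cycles with zero diagonal already force \<lambda>(A) \<ge> 0, and dividing by
  the cycle length preserves the sign, so only the upper bound on cycle sums remains.\<close>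

lemma definite_iff:
  "definite A \<longleftrightarrow>
    (\<forall>(\<tau>, K)\<in>cyclic_perms. (\<Sum>i\<in>K. A $ i $ \<tau> i) \<le> 0) \<and> (\<forall>i. A $ i $ i = 0)"
proof -
  have "max_cycle_mean A = 0 \<longleftrightarrow> max_cycle_mean A \<le> 0" if "\<forall>i. A $ i $ i = 0"
    using max_cycle_mean_ge_diagonal[of A] that by (metis antisym order_refl)
  moreover have "max_cycle_mean A \<le> 0 \<longleftrightarrow>
      (\<forall>(\<tau>, K)\<in>cyclic_perms. (\<Sum>i\<in>K. A $ i $ \<tau> i) \<le> 0)"
    unfolding max_cycle_mean_le_iff using cycle_mean_le_0_iff by fastforce
  ultimately show ?thesis
    by (auto simp: definite_def)
qed

lemma cycle_sum_le_0_if_solution: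
  assumes "x \<in> solution_set A" "\<tau> permutes K"
  shows "(\<Sum>i\<in>K. A $ i $ \<tau> i) \<le> 0"
proof -
  have "(\<Sum>i\<in>K. A $ i $ \<tau> i) \<le> (\<Sum>i\<in>K. ereal (x $ i - x $ \<tau> i))"
    using assms(1) by (intro sum_mono) (simp add: solution_set_def)
  also have "\<dots> = ereal (\<Sum>i\<in>K. x $ i - x $ \<tau> i)"
    by simp
  \<comment> \<open>Reindexing the sum of \<open>x\<close> over \<open>K\<close> by the permutation
    \<open>\<tau>\<close> makes the two halves cancel.\<close>
  also have "(\<Sum>i\<in>K. x $ i - x $ \<tau> i) = 0"
    using sum.permute[OF assms(2), of "($) x"] by (simp add: sum_subtractf o_def)
  finally show ?thesis by (simp add: zero_ereal_def)
qed

text \<open>Distinct vertices make the closed walk the cycle of a cyclic permutation of its vertex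
  set; for empty \<open>p\<close> it is the loop at \<open>i\<close>.\<close>

lemma walk_weight_closed_le_0:
  fixes A :: "ereal^'n::finite^'n"
  assumes "definite A" "distinct (i # p)"
  shows "walk_weight (\<lambda>i j. A $ i $ j) (i # p @ [i]) \<le> 0"
proof -
  let ?c = "i # p" and ?w = "\<lambda>i j. A $ i $ j"
  let ?f = "cycle_of_list ?c"
  have "(?f, set ?c) \<in> cyclic_perms"
    using cyclic_on_cycle_of_list[OF assms(2)] cycle_permutes[of ?c]
    by (simp add: cyclic_perms_def)
  then have "(\<Sum>j\<in>set ?c. A $ j $ ?f j) \<le> 0"
    using assms(1) unfolding definite_iff by blast
  also have "(\<Sum>j\<in>set ?c. A $ j $ ?f j) = sum_list (map (\<lambda>j. A $ j $ ?f j) ?c)"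
    using assms(2) by (subst sum_list_distinct_conv_sum_set) simp_all
  also have "map (\<lambda>j. A $ j $ ?f j) ?c = map2 ?w ?c (map ?f ?c)"
    by (simp only: zip_map2 zip_same_conv_map map_map) simp
  finally show ?thesis
    by (simp only: map_cycle_of_list[OF assms(2)] walk_weight_closed)
qed

lemma solution_exists_if_definite:
  fixes A :: "ereal^'n::finite^'n"
  assumes "definite A" "\<And>i j. A $ i $ j < \<infinity>"
  shows "solution_set A \<noteq> {}"
proof -
  define w where "w = walk_weight (\<lambda>i j. A $ i $ j)"
  \<comment> \<open>Only the tail after \<open>i\<close> is stored, so each member stands for a
    simple path starting at \<open>i\<close>.\<close>
  define P where "P i = {p. distinct (i # p)}" for i :: 'n
  define X where "X i = Max ((\<lambda>p. w (i # p)) ` P i)" for i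
  have "finite {p :: 'n list. set p \<subseteq> UNIV \<and> distinct p}"
    by (rule finite_subset_distinct) simp
  then have fin: "finite (P i)" for i
    by (rule rev_finite_subset) (auto simp: P_def)
  have nil: "[] \<in> P i" for i
    by (simp add: P_def)
  have le_X: "w (i # p) \<le> X i" if "p \<in> P i" for i p
    using that fin[of i] by (auto simp: X_def intro!: Max_ge)
  have attained: "\<exists>p\<in>P i. X i = w (i # p)" for i
    unfolding X_def using Max_in[of "(\<lambda>p. w (i # p)) ` P i"] fin[of i] nil[of i] by blast
  have finite_X: "\<bar>X i\<bar> \<noteq> \<infinity>" for i
  proof -
    have "0 \<le> X i"
      using le_X[OF nil, of i] by (simp add: w_def)
    \<comment> \<open>The maximum is the weight of an actual path, whose arcs all weigh less than
      \<infinity>.\<close>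
    moreover have "X i < \<infinity>"
      using attained[of i] walk_weight_less_top[of "\<lambda>i j. A $ i $ j", OF assms(2)]
      by (metis w_def)
    ultimately show ?thesis by auto
  qed
  have step: "A $ i $ j + X j \<le> X i" for i j
  proof -
    obtain p where p: "p \<in> P j" "X j = w (j # p)"
      using attained by blast
    have eq: "A $ i $ j + X j = w (i # j # p)"
      by (simp add: p(2) w_def)
    show ?thesis
    proof (cases "i \<in> set (j # p)")
      case False
      then have "j # p \<in> P i"
        using p(1) by (simp add: P_def)
      then show ?thesis
        using eq le_X by metis
    next
      case True
      then obtain q r where qr: "j # p = q @ i # r"
        by (meson split_list)
      have dist: "distinct (q @ i # r)"
        using p(1) unfolding qr[symmetric] P_def by simp
      \<comment> \<open>Cut at the return to \<open>i\<close>: the first piece is a cycle (a loop if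
        \<open>i = j\<close>), the second a simple path from \<open>i\<close>.\<close>
      have "w (i # j # p) = w (i # q @ [i]) + w (i # r)"
        using walk_weight_append[of _ "i # q"] by (simp add: qr w_def)
      also have "\<dots> \<le> 0 + X i"
        using dist walk_weight_closed_le_0[OF assms(1), of i q] le_X[of r i]
        by (intro add_mono) (auto simp: w_def P_def)
      finally show ?thesis
        using eq by simp
    qed
  qed
  have "(\<chi> i. real_of_ereal (X i)) \<in> solution_set A"
  proof -
    have "A $ i $ j \<le> ereal (real_of_ereal (X i) - real_of_ereal (X j))" for i j
      \<comment> \<open>With \<open>X i\<close> and \<open>X j\<close> real, \<open>step\<close>
        rearranges to the required inequality; an entry -\<infinity> satisfies it trivially.\<close>
      using step[of i j] finite_X[of i] finite_X[of j]
      by (cases "A $ i $ j"; cases "X i"; cases "X j") auto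
    then show ?thesis
      by (simp add: solution_set_def)
  qed
  then show ?thesis by blast
qed

theorem proposition12:
  fixes E :: "('n::finite \<times> 'n) set" and a :: "'n \<Rightarrow> 'n \<Rightarrow> ereal"
  assumes "\<And>i j. (i, j) \<in> E \<Longrightarrow> i \<noteq> j"
    and "\<And>i j. (i, j) \<in> E \<Longrightarrow> a i j \<in> Rmax"
  shows "solution_set (system_matrix E a) \<noteq> {} \<longleftrightarrow> definite (system_matrix E a)"
proof
  let ?A = "system_matrix E a"
  have diag: "?A $ i $ i = 0" for i
    by (simp add: system_matrix_def)
  \<comment> \<open>Keeps path weights, and hence the constructed solution, from being
    \<infinity>.\<close>
  have less_top: "?A $ i $ j < \<infinity>" for i j
    using assms(2)[of i j] by (auto simp: system_matrix_def Rmax_def)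
  show "definite ?A" if "solution_set ?A \<noteq> {}"
    using that diag cycle_sum_le_0_if_solution[of _ ?A]
    by (auto simp: definite_iff cyclic_perms_def)
  show "solution_set ?A \<noteq> {}" if "definite ?A"
    using solution_exists_if_definite[OF that] less_top by blast
qed

end
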